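(* Let $G$ be a connected, reduced bipartite graph with partite sets $A=\{a_1,\dots,a_m\}$ and $B$, where $m=|A|\le |B|$ and $m=2k$ with $k\ge 3$. Suppose the poset $P_A$ has height $h(P_A)=2$ and contains at least two disjoint chains of size two. Then $\mathcal{R}(G)\le k$.
   Context: $N(x)$ denotes the neighborhood of a vertex $x$. A graph is reduced if no two vertices have the same neighborhood. $P_A$ is the poset on $A$ given by $a\preceq b$ iff $N(a)\subseteq N(b)$ (the poset induced by the neighborhood inclusion graph of $G$ with respect to $A$). A chain is a set of pairwise comparable elements; the height $h(P_A)$ is the maximum size of a chain. Letters $x,y$ alternate in a word $w$ if the subsequence of $w$ consisting of occurrences of $x$ and $y$ is $xyxy\cdots$ or $yxyx\cdots$. A word $w$ over the vertex set of a graph (containing every vertex) represents the graph if two vertices are adjacent iff they alternate in $w$. A word is $k$-uniform if each letter occurs exactly $k$ times. $\mathcal{R}(G)$ is the least $k$ such that some $k$-uniform word represents $G$. *)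

theory Defs
  imports "Graph_Theory.Digraph_Component" "HOL-Library.Extended_Nat"
begin

text \<open>Finite simple graphs are the symmetric digraphs of the locale \<^locale>\<open>graph\<close>.\<close>

definition nbhd :: "('a, 'b) pre_digraph \<Rightarrow> 'a \<Rightarrow> 'a set" where
  "nbhd G x = {y. x \<rightarrow>\<^bsub>G\<^esub> y}"

definition reduced_graph :: "('a, 'b) pre_digraph \<Rightarrow> bool" where
  "reduced_graph G \<longleftrightarrow> (\<forall>x\<in>verts G. \<forall>y\<in>verts G. x \<noteq> y \<longrightarrow> nbhd G x \<noteq> nbhd G y)"

definition bipartition :: "('a, 'b) pre_digraph \<Rightarrow> 'a set \<Rightarrow> 'a set \<Rightarrow> bool" where
  "bipartition G A B \<longleftrightarrow> A \<union> B = verts G \<and> A \<inter> B = {} \<and>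
     (\<forall>x y. x \<rightarrow>\<^bsub>G\<^esub> y \<longrightarrow> x \<in> A \<and> y \<in> B \<or> x \<in> B \<and> y \<in> A)"

definition nbhd_poset :: "('a, 'b) pre_digraph \<Rightarrow> 'a set \<Rightarrow> 'a rel" where
  "nbhd_poset G A = relation_of (\<lambda>a b. nbhd G a \<subseteq> nbhd G b) A"

lemma partial_order_on_nbhd_poset:
  assumes "reduced_graph G" "A \<subseteq> verts G"
  shows "partial_order_on A (nbhd_poset G A)"
  unfolding nbhd_poset_def
proof (rule partial_order_on_relation_ofI)
  fix a b assume "a \<in> A" "b \<in> A" "nbhd G a \<subseteq> nbhd G b" "nbhd G b \<subseteq> nbhd G a"
  then show "a = b" using assms unfolding reduced_graph_def by blast
qed auto

text \<open>Intended for relations with finite field, where \<^const>\<open>Max\<close> is meaningful.\<close>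

definition poset_height :: "'a rel \<Rightarrow> nat" where
  "poset_height r = Max (card ` Chains r)"

fun alt_word :: "'a \<Rightarrow> 'a \<Rightarrow> nat \<Rightarrow> 'a list" where
  "alt_word x y 0 = []"
| "alt_word x y (Suc n) = x # alt_word y x n"

definition alternate_in :: "'a list \<Rightarrow> 'a \<Rightarrow> 'a \<Rightarrow> bool" where
  "alternate_in w x y \<longleftrightarrow>
     (\<exists>n. filter (\<lambda>z. z = x \<or> z = y) w = alt_word x y n \<or>
          filter (\<lambda>z. z = x \<or> z = y) w = alt_word y x n)"

definition represents :: "'a list \<Rightarrow> ('a, 'b) pre_digraph \<Rightarrow> bool" where
  "represents w G \<longleftrightarrow> set w = verts G \<and>
     (\<forall>x\<in>verts G. \<forall>y\<in>verts G. x \<noteq> y \<longrightarrow> (x \<rightarrow>\<^bsub>G\<^esub> y \<longleftrightarrow> alternate_in w x y))"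

definition uniform_word :: "nat \<Rightarrow> 'a list \<Rightarrow> bool" where
  "uniform_word k w \<longleftrightarrow> (\<forall>x\<in>set w. count_list w x = k)"

text \<open>The value is \<open>\<infinity>\<close> if no uniform word represents the graph, so that an upper bound
  by a natural number includes the existence of a representing uniform word.\<close>

definition rep_number :: "('a, 'b) pre_digraph \<Rightarrow> enat" where
  "rep_number G = (INF k \<in> {k. \<exists>w. uniform_word k w \<and> represents w G}. enat k)"

end

theory Submission
  imports Defs
begin

text \<open>Take \<open>k\<close> permutations of \<open>A\<close> in a row and put every letter of \<open>B\<close> at the end of each of them:
  then every \<open>a \<in> A\<close> alternates with every \<open>b \<in> B\<close>. Alternation with a non-neighbour \<open>a\<close> is
  destroyed by moving one occurrence of \<open>b\<close> across an \<open>a\<close> next to one of the seams between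
  consecutive permutations. For two chains \<open>a\<^sub>1 < a\<^sub>2\<close> and \<open>b\<^sub>1 < b\<^sub>2\<close>, partition \<open>A\<close> into the \<open>k - 1\<close>
  groups \<open>c, a\<^sub>1, a\<^sub>2\<close> and \<open>d, b\<^sub>1, b\<^sub>2\<close> and pairs \<open>y, x\<close>, and give the seams the forms
  \<open>a\<^sub>2 a\<^sub>1 | c a\<^sub>1 a\<^sub>2\<close>, \<open>b\<^sub>2 b\<^sub>1 | d b\<^sub>1 b\<^sub>2\<close> and \<open>x | y x\<close>. A non-neighbour \<open>a\<^sub>2\<close> of \<open>b\<close> forces the
  non-neighbour \<open>a\<^sub>1\<close>, so the non-neighbours of \<open>b\<close> in a group are exactly the letters directly to the
  left or directly to the right of the bar, and one move of \<open>b\<close> crosses all of them and nothing else.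
  The end of the last permutation is not needed for any group; there \<open>B\<close> is listed in the order opposite to
  that at the first seam, which makes \<open>B\<close> independent. Each group is a prefix of some permutation
  and, up to reversal, a subword of another one, which makes \<open>A\<close> independent.\<close>

section \<open>Restrictions of words to two letters, and alternation\<close>

lemma filter_eq_single:
  assumes "distinct xs" "a \<in> set xs"
  shows "filter (\<lambda>z. z = a) xs = [a]"
  using assms by (induction xs) (auto simp: filter_empty_conv)

lemma filter_eq_none: "a \<notin> set xs \<Longrightarrow> filter (\<lambda>z. z = a) xs = []"
  by (auto simp: filter_empty_conv)

lemma filter_pair_cases:
  assumes "distinct xs" "x \<in> set xs" "y \<in> set xs" "x \<noteq> y"
  shows "filter (\<lambda>z. z = x \<or> z = y) xs = [x, y] \<or> filter (\<lambda>z. z = x \<or> z = y) xs = [y, x]"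
  using assms
proof (induction xs)
  case (Cons u xs)
  consider "u = x" | "u = y" | "u \<noteq> x" "u \<noteq> y" by blast
  then show ?case
  proof cases
    case 1
    then have "filter (\<lambda>z. z = x \<or> z = y) xs = filter (\<lambda>z. z = y) xs"
      using Cons.prems by (intro filter_cong) auto
    then show ?thesis using 1 Cons.prems by (simp add: filter_eq_single)
  next
    case 2
    then have "filter (\<lambda>z. z = x \<or> z = y) xs = filter (\<lambda>z. z = x) xs"
      using Cons.prems by (intro filter_cong) auto
    then show ?thesis using 2 Cons.prems by (simp add: filter_eq_single)
  next
    case 3
    then show ?thesis using Cons by auto
  qed
qed simp

lemma filter_pair_inner:
  assumes "xs = us @ vs @ ws" "distinct xs" "x \<in> set vs" "y \<in> set vs"
  shows "filter (\<lambda>z. z = x \<or> z = y) xs = filter (\<lambda>z. z = x \<or> z = y) vs"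
proof -
  have "filter (\<lambda>z. z = x \<or> z = y) us = []" "filter (\<lambda>z. z = x \<or> z = y) ws = []"
    using assms by (auto simp: filter_empty_conv)
  then show ?thesis by (simp add: assms(1))
qed

lemma alternate_in_commute: "alternate_in w x y \<longleftrightarrow> alternate_in w y x"
proof -
  have "(\<lambda>z. z = x \<or> z = y) = (\<lambda>z. z = y \<or> z = x)" by auto
  then show ?thesis unfolding alternate_in_def by auto
qed

lemma length_alt_word: "length (alt_word x y n) = n"
  by (induction n arbitrary: x y) auto

lemma alt_word_even: "alt_word x y (2 * n) = concat (replicate n [x, y])"
  by (induction n) auto

lemma alt_word_no_repeat: "x \<noteq> y \<Longrightarrow> alt_word x y n \<noteq> u @ z # z # v"
proof (induction n arbitrary: x y u)
  case (Suc n)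
  show ?case
  proof (cases u)
    case Nil
    then show ?thesis using Suc.prems by (cases n) auto
  next
    case (Cons c u')
    then show ?thesis using Suc.IH[of y x u'] Suc.prems by auto
  qed
qed simp

lemma not_alternate_in_repeat:
  assumes "x \<noteq> y" "filter (\<lambda>z. z = x \<or> z = y) w = u @ t # t # v"
  shows "\<not> alternate_in w x y"
  using alt_word_no_repeat[of x y] alt_word_no_repeat[of y x] assms(1)
  unfolding alternate_in_def assms(2) by (metis (no_types))

lemma alternate_in_blocks:
  assumes "filter (\<lambda>z. z = x \<or> z = y) w = concat (replicate n [x, y])"
  shows "alternate_in w x y"
  unfolding alternate_in_def assms by (metis alt_word_even)

text \<open>An alternating word of length \<open>2 * n\<close> is a power of a single two-letter
  block, so alternation would force all blocks to agree. To separate two letters of the same side it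
  is thus enough to find two blocks that order them differently.\<close>

lemma not_alternate_in_blocks:
  assumes blocks: "\<And>i. i < n \<Longrightarrow> f i = [x, y] \<or> f i = [y, x]"
    and w: "filter (\<lambda>z. z = x \<or> z = y) w = concat (map f [0..<n])"
    and "i < n" "j < n" "f i \<noteq> f j"
  shows "\<not> alternate_in w x y"
proof
  have len: "length (f i) = 2" if "i < n" for i
    using blocks[OF that] by auto
  have const: "f i = f j" if eq: "concat (map f [0..<n]) = alt_word u v l" for u v l
  proof -
    have "length (concat (map f [0..<n])) = 2 * n"
      using len by (simp add: length_concat sum_list_sum_nth)
    then have "l = 2 * n" using eq by (simp add: length_alt_word)
    then have "concat (map f [0..<n]) = concat (replicate n [u, v])"
      using eq alt_word_even[of u v n] by simp
    \<comment> \<open>Both lists of blocks have \<open>n\<close> entries of length two, so equal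
      concatenations have equal entries.\<close>
    then have "map f [0..<n] = replicate n [u, v]"
      by (rule concat_injective) (auto simp: set_zip len)
    then have "f t = [u, v]" if "t < n" for t
      using that by (metis add_0 length_upt minus_nat.diff_0 nth_map nth_replicate nth_upt)
    then show ?thesis using assms(3,4) by simp
  qed
  assume "alternate_in w x y"
  then show False
    using const assms(5) unfolding alternate_in_def w by blast
qed

section \<open>Inserting letters at prescribed positions\<close>

text \<open>Inserts the letters of \<open>bs\<close> into \<open>zs\<close>, each \<open>b\<close> after the first \<open>s b\<close> letters of \<open>zs\<close>.\<close>

fun weave :: "('a \<Rightarrow> nat) \<Rightarrow> 'a list \<Rightarrow> 'a list \<Rightarrow> 'a list" where
  "weave s bs [] = bs"
| "weave s bs (z # zs) =
     filter (\<lambda>b. s b = 0) bs @ z # weave (\<lambda>b. s b - 1) (filter (\<lambda>b. s b \<noteq> 0) bs) zs"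

lemma set_weave: "set (weave s bs zs) = set bs \<union> set zs"
  by (induction s bs zs rule: weave.induct) auto

lemma filter_weave_letters:
  assumes "\<And>b. b \<in> set bs \<Longrightarrow> \<not> P b"
  shows "filter P (weave s bs zs) = filter P zs"
  using assms by (induction s bs zs rule: weave.induct) (auto simp: filter_empty_conv)

lemma distinct_filter_weave:
  assumes "distinct bs" "set zs \<inter> set bs = {}" "set bs \<subseteq> S" "set zs \<inter> S = {}"
  shows "distinct (filter (\<lambda>z. z \<in> S) (weave s bs zs))"
  using assms
  by (induction s bs zs rule: weave.induct) (auto simp: set_weave)

text \<open>The other inserted letters vanish under the filter, so the place of \<open>b\<close> is
  governed by \<open>s b\<close> alone: each letter of \<open>bs\<close> can be moved independently
  of the rest.\<close>

lemma filter_weave_pair: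
  assumes "distinct bs" "b \<in> set bs" "a \<notin> set bs" "b \<notin> set zs"
  shows "filter (\<lambda>z. z = a \<or> z = b) (weave s bs zs) =
    filter (\<lambda>z. z = a) (take (s b) zs) @ b # filter (\<lambda>z. z = a) (drop (s b) zs)"
  using assms
proof (induction s bs zs rule: weave.induct)
  case (1 s bs)
  then have "filter (\<lambda>z. z = a \<or> z = b) bs = filter (\<lambda>z. z = b) bs"
    by (intro filter_cong) auto
  then show ?case using 1 by (simp add: filter_eq_single)
next
  case (2 s bs z zs)
  show ?case
  proof (cases "s b")
    case 0
    have "filter (\<lambda>u. u = a \<or> u = b) (filter (\<lambda>b. s b = 0) bs)
        = filter (\<lambda>u. u = b) (filter (\<lambda>b. s b = 0) bs)"
      using 2 by (intro filter_cong) auto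
    also have "\<dots> = [b]" using 2 0 by (intro filter_eq_single) auto
    finally have b: "filter (\<lambda>u. u = a \<or> u = b) (filter (\<lambda>b. s b = 0) bs) = [b]" .
    have "filter (\<lambda>u. u = a \<or> u = b) (weave (\<lambda>b. s b - 1) (filter (\<lambda>b. s b \<noteq> 0) bs) zs)
        = filter (\<lambda>u. u = a \<or> u = b) zs"
      using 2 0 by (intro filter_weave_letters) auto
    also have "\<dots> = filter (\<lambda>u. u = a) zs"
      using 2 by (intro filter_cong) auto
    finally show ?thesis using b 0 2 by (auto simp del: filter_filter)
  next
    case (Suc n)
    have "filter (\<lambda>u. u = a \<or> u = b) (filter (\<lambda>b. s b = 0) bs) = []"
      using 2 Suc by (auto simp: filter_empty_conv)
    then show ?thesis using 2 Suc by (auto simp del: filter_filter)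
  qed
qed

text \<open>The same word with other brackets: a piece at the end of one block is counted as the
  beginning of the next. This turns blocks into permutations.\<close>

lemma concat_shift:
  assumes "r 0 = []"
  shows "concat (map (\<lambda>i. f i @ r (Suc i)) [0..<n]) = concat (map (\<lambda>i. r i @ f i) [0..<n]) @ r n"
  using assms by (induction n) auto

section \<open>The word built from a list of groups\<close>

text \<open>Keeps only what the construction uses of the graph. In \<open>nested\<close> the head of
  a group is free, while in its tail the non-neighbours of each \<open>b\<close> precede the
  neighbours; this is true of an increasing chain of neighbourhoods and of a tail with one
  letter.\<close>

locale seam_word =
  fixes groups :: "'a list list" and bs :: "'a list" and adj :: "'a \<Rightarrow> 'a \<Rightarrow> bool"
  assumes two_groups: "2 \<le> length groups"
    and distinct_groups: "distinct (concat groups)"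
    and nonempty_groups: "[] \<notin> set groups"
    and distinct_bs: "distinct bs"
    and disjoint: "set (concat groups) \<inter> set bs = {}"
    and nested: "\<And>xs b. xs \<in> set groups \<Longrightarrow> b \<in> set bs \<Longrightarrow>
      \<exists>p q. tl xs = p @ q \<and> (\<forall>a\<in>set p. \<not> adj a b) \<and> (\<forall>a\<in>set q. adj a b)"
begin

definition grp :: "nat \<Rightarrow> 'a list" where
  "grp i = (if i < length groups then groups ! i else [])"

text \<open>Seam \<open>j\<close> lies between permutations \<open>j\<close> and
  \<open>Suc j\<close>, so group \<open>j\<close> opens permutation \<open>Suc j\<close>; no seam
  precedes permutation 0.\<close>

definition front :: "nat \<Rightarrow> 'a list" where
  "front i = (case i of 0 \<Rightarrow> [] | Suc j \<Rightarrow> grp j)"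

text \<open>For a tail \<open>p @ q\<close> this is \<open>rev q @ rev p\<close>, which puts
  \<open>p\<close> next to the bar. The head is left out: a leftward move is made when the head is a
  neighbour, which must not be crossed.\<close>

definition rear :: "nat \<Rightarrow> 'a list" where
  "rear i = rev (tl (grp i))"

text \<open>The reversal serves two letters of the same group: here they come in the order opposite
  to that in \<open>grp\<close>.\<close>

definition mid :: "nat \<Rightarrow> 'a list" where
  "mid i = filter (\<lambda>x. x \<notin> set (front i) \<union> set (rear i)) (rev (concat groups))"

definition perm :: "nat \<Rightarrow> 'a list" where
  "perm i = front i @ mid i @ rear i"

text \<open>The value at the last seam, where \<open>grp i = []\<close>, is irrelevant.\<close>

definition cut :: "nat \<Rightarrow> 'a \<Rightarrow> nat" where
  "cut i b = (let n = length (takeWhile (\<lambda>a. \<not> adj a b) (tl (grp i))) in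
     if adj (hd (grp i)) b then length (rear i) - n else length (rear i) + 1 + n)"

text \<open>The last order reverses the one in which \<open>bs\<close> appears in block 0. The
  \<open>weave\<close> term is written out because \<open>block\<close> is itself defined from
  \<open>order\<close>.\<close>

definition order :: "nat \<Rightarrow> 'a list" where
  "order i = (if i < length groups then bs
     else rev (filter (\<lambda>z. z \<in> set bs) (weave (cut 0) bs (rear 0 @ grp 0))))"

text \<open>The word is divided after \<open>grp i\<close> and not at the bar, so that every move of
  a letter of \<open>bs\<close> stays within one block.\<close>

definition block :: "nat \<Rightarrow> 'a list" where
  "block i = mid i @ weave (cut i) (order i) (rear i @ grp i)"

definition word :: "'a list" where
  "word = concat (map block [0..<Suc (length groups)])"

section \<open>Groups, permutations and orders\<close>

lemma set_grp: "set (grp i) \<subseteq> set (concat groups)"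
  by (auto simp: grp_def intro: nth_mem)

lemma distinct_grp: "distinct (grp i)"
  using distinct_groups by (auto simp: grp_def distinct_concat_iff)

lemma grp_disjoint:
  assumes "i \<noteq> j" shows "set (grp i) \<inter> set (grp j) = {}"
proof (cases "i < length groups \<and> j < length groups")
  case True
  \<comment> \<open>Only the empty list can be repeated in a distinct concatenation, and
    \<open>nonempty_groups\<close> excludes it.\<close>
  have "distinct (removeAll [] groups)"
    using distinct_groups by (simp add: distinct_concat_iff)
  then have "distinct groups" using nonempty_groups by simp
  then have "groups ! i \<noteq> groups ! j"
    using True assms by (simp add: nth_eq_iff_index_eq)
  then show ?thesis
    using True distinct_groups by (auto simp: grp_def distinct_concat_iff)
qed (auto simp: grp_def)

lemma grp_cover: "a \<in> set (concat groups) \<Longrightarrow> \<exists>i<length groups. a \<in> set (grp i)"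
  by (metis UN_E grp_def in_set_conv_nth set_concat)

lemma front_0: "front 0 = []" and front_Suc: "front (Suc i) = grp i"
  by (auto simp: front_def)

lemma set_rear: "set (rear i) \<subseteq> set (grp i)"
  by (cases "grp i") (auto simp: rear_def)

lemma front_disjoint: "set (front i) \<inter> set (grp i) = {}"
  using grp_disjoint[of "i - 1" i] by (cases i) (auto simp: front_def)

lemma set_front: "set (front i) \<subseteq> set (concat groups)"
  using set_grp by (cases i) (auto simp: front_def)

lemma distinct_perm: "distinct (perm i)"
proof -
  have "distinct (front i)" by (cases i) (auto simp: front_def distinct_grp)
  moreover have "distinct (rear i)" by (simp add: rear_def distinct_grp distinct_tl)
  ultimately show ?thesis
    using distinct_groups front_disjoint[of i] set_rear[of i]
    by (auto simp: perm_def mid_def simp del: set_concat)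
qed

lemma set_perm: "set (perm i) = set (concat groups)"
  using set_front[of i] set_rear[of i] set_grp[of i]
  by (auto simp: perm_def mid_def simp del: set_concat)

lemma set_order: "set (order i) = set bs"
  by (auto simp: order_def set_weave)

lemma distinct_order: "distinct (order i)"
proof -
  have "set (rear 0 @ grp 0) \<inter> set bs = {}"
    using set_rear[of 0] set_grp[of 0] disjoint by auto
  then show ?thesis
    using distinct_bs by (auto simp: order_def intro!: distinct_filter_weave)
qed

section \<open>Restrictions of the word, and its uniformity\<close>

lemma grp_last: "grp (length groups) = []"
  by (simp add: grp_def)

lemma rear_last: "rear (length groups) = []"
  by (simp add: rear_def grp_last)

lemma seam_not_bs: "b \<in> set bs \<Longrightarrow> b \<notin> set (mid i) \<and> b \<notin> set (rear i @ grp i)"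
  using set_rear[of i] set_grp[of i] disjoint by (auto simp: mid_def)

text \<open>Without \<open>bs\<close> the insertions leave no trace, and \<open>concat_shift\<close>
  returns each group to the permutation that it opens; nothing is left over because the last group
  is empty.\<close>

lemma filter_word_letters:
  assumes "\<And>b. b \<in> set bs \<Longrightarrow> \<not> P b"
  shows "filter P word = concat (map (\<lambda>i. filter P (perm i)) [0..<Suc (length groups)])"
proof -
  have "filter P (block i) = (filter P (mid i) @ filter P (rear i)) @ filter P (front (Suc i))" for i
    using assms filter_weave_letters[of "order i" P] by (simp add: block_def set_order front_Suc)
  then have "filter P word = concat (map (\<lambda>i. (filter P (mid i) @ filter P (rear i))
      @ filter P (front (Suc i))) [0..<Suc (length groups)])"
    by (simp only: word_def filter_concat map_map o_def)
  also have "\<dots> = concat (map (\<lambda>i. filter P (front i) @ filter P (mid i) @ filter P (rear i))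
      [0..<Suc (length groups)]) @ filter P (front (Suc (length groups)))"
    by (rule concat_shift) (simp add: front_0)
  finally show ?thesis
    by (simp add: perm_def front_Suc grp_last)
qed

lemma filter_word: "filter P word = concat (map (\<lambda>i. filter P (block i)) [0..<Suc (length groups)])"
  by (simp only: word_def filter_concat map_map o_def)

lemma filter_block_bs:
  "filter (\<lambda>z. z \<in> set bs) (block i) =
    filter (\<lambda>z. z \<in> set bs) (weave (cut i) (order i) (rear i @ grp i))"
  using seam_not_bs by (auto simp: block_def filter_empty_conv)

lemma distinct_block_bs: "distinct (filter (\<lambda>z. z \<in> set bs) (block i))"
  unfolding filter_block_bs
  using seam_not_bs by (intro distinct_filter_weave) (auto simp: set_order distinct_order)

lemma set_block_bs: "b \<in> set bs \<Longrightarrow> b \<in> set (filter (\<lambda>z. z \<in> set bs) (block i))"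
  by (simp add: block_def set_weave set_order)

lemma filter_filter_block_bs:
  assumes "\<And>z. P z \<Longrightarrow> z \<in> set bs"
  shows "filter P (block i) = filter P (filter (\<lambda>z. z \<in> set bs) (block i))"
  using assms by (auto intro: filter_cong)

lemma set_word: "set word = set (concat groups) \<union> set bs"
proof -
  have word: "set word = (\<Union>i\<le>length groups. set (mid i) \<union> set bs \<union> set (rear i) \<union> set (grp i))"
    by (auto simp: word_def block_def set_weave set_order atLeast0LessThan lessThan_Suc_atMost
        simp del: upt_Suc)
  have sub: "set (mid i) \<union> set bs \<union> set (rear i) \<union> set (grp i) \<subseteq> set (concat groups) \<union> set bs" for i
    using set_rear[of i] set_grp[of i] by (auto simp: mid_def simp del: set_concat)
  have "set (concat groups) \<union> set bs \<subseteq> set word"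
    unfolding word by (auto dest!: grp_cover simp del: set_concat intro: less_imp_le)
  moreover have "set word \<subseteq> set (concat groups) \<union> set bs"
    unfolding word by (intro UN_least sub)
  ultimately show ?thesis by (intro equalityI)
qed

lemma count_list_letter:
  assumes "a \<in> set (concat groups)"
  shows "count_list word a = Suc (length groups)"
proof -
  have "filter (\<lambda>z. z = a) word = concat (map (\<lambda>i. [a]) [0..<Suc (length groups)])"
    using assms disjoint set_perm distinct_perm
    by (subst filter_word_letters) (auto simp: filter_eq_single simp del: upt_Suc)
  then have "length (filter (\<lambda>z. z = a) word) = Suc (length groups)"
    by (simp add: length_concat del: upt_Suc)
  moreover have "(\<lambda>z. z = a) = (=) a" by auto
  ultimately show ?thesis by (simp add: count_list_eq_length_filter)
qed

lemma count_list_bs: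
  assumes "b \<in> set bs"
  shows "count_list word b = Suc (length groups)"
proof -
  have "filter (\<lambda>z. z = b) (block i) = [b]" for i
    using assms by (subst filter_filter_block_bs)
      (auto intro!: filter_eq_single distinct_block_bs set_block_bs simp del: filter_filter)
  then have "filter (\<lambda>z. z = b) word = concat (map (\<lambda>i. [b]) [0..<Suc (length groups)])"
    by (simp only: filter_word)
  then have "length (filter (\<lambda>z. z = b) word) = Suc (length groups)"
    by (simp add: length_concat del: upt_Suc)
  moreover have "(\<lambda>z. z = b) = (=) b" by auto
  ultimately show ?thesis by (simp add: count_list_eq_length_filter)
qed

section \<open>Independence of each side\<close>

lemma not_alternate_bs:
  assumes "b \<in> set bs" "b' \<in> set bs" "b \<noteq> b'"
  shows "\<not> alternate_in word b b'"
proof -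
  let ?P = "\<lambda>z. z = b \<or> z = b'"
  let ?n = "length groups"
  have pair: "filter ?P (block i) = [b, b'] \<or> filter ?P (block i) = [b', b]" for i
  proof -
    have "filter ?P (block i) = filter ?P (filter (\<lambda>z. z \<in> set bs) (block i))"
      using assms by (intro filter_filter_block_bs) auto
    moreover have "filter ?P (filter (\<lambda>z. z \<in> set bs) (block i)) \<in> {[b, b'], [b', b]}"
      using filter_pair_cases[OF distinct_block_bs set_block_bs[OF assms(1)]
          set_block_bs[OF assms(2)] assms(3)] by blast
    ultimately show ?thesis by simp
  qed
  \<comment> \<open>At the last seam there is nothing to weave into, so \<open>order ?n\<close>
    appears unchanged, and it was chosen as the reverse of the order in block 0.\<close>
  have "filter ?P (block ?n) = filter ?P (rev (filter (\<lambda>z. z \<in> set bs) (block 0)))"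
  proof -
    have "filter ?P (mid ?n) = []"
      using seam_not_bs assms by (auto simp: filter_empty_conv)
    moreover have "order 0 = bs" using two_groups by (auto simp: order_def)
    then have "order ?n = rev (filter (\<lambda>z. z \<in> set bs) (block 0))"
      by (simp add: filter_block_bs) (simp add: order_def)
    ultimately show ?thesis
      by (simp add: block_def[of ?n] grp_last rear_last del: filter_filter)
  qed
  also have "\<dots> = rev (filter ?P (block 0))"
    using assms filter_filter_block_bs[of ?P 0] by (metis rev_filter)
  finally have "filter ?P (block 0) \<noteq> filter ?P (block ?n)"
    using pair[of 0] assms by auto
  then show ?thesis
    using pair by (intro not_alternate_in_blocks[where n = "Suc ?n"
          and f = "\<lambda>i. filter ?P (block i)" and i = 0 and j = ?n] filter_word) auto
qed

lemma not_alternate_letters: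
  assumes "x \<in> set (concat groups)" "y \<in> set (concat groups)" "x \<noteq> y"
  shows "\<not> alternate_in word x y"
proof -
  let ?P = "\<lambda>z. z = x \<or> z = y"
  let ?n = "length groups"
  have pair: "filter ?P (perm i) = [x, y] \<or> filter ?P (perm i) = [y, x]" for i
    using assms by (intro filter_pair_cases distinct_perm) (auto simp only: set_perm)
  obtain g h where g: "g < ?n" "x \<in> set (grp g)" and h: "h < ?n" "y \<in> set (grp h)"
    using grp_cover assms by metis
  have "\<exists>i j. i \<le> ?n \<and> j \<le> ?n \<and> filter ?P (perm i) \<noteq> filter ?P (perm j)"
  proof (cases "g = h")
    case False
    then have "y \<notin> set (grp g)" "x \<notin> set (grp h)"
      using g h grp_disjoint by blast+
    then have "filter ?P (grp g) = filter (\<lambda>z. z = x) (grp g)"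
      "filter ?P (grp h) = filter (\<lambda>z. z = y) (grp h)"
      by (auto intro!: filter_cong)
    then have "filter ?P (grp g) = [x]" "filter ?P (grp h) = [y]"
      using g h distinct_grp by (simp_all add: filter_eq_single)
    \<comment> \<open>Each group opens a permutation: \<open>x\<close> comes first in one of these
      two and \<open>y\<close> in the other.\<close>
    then have "filter ?P (perm (Suc g)) \<noteq> filter ?P (perm (Suc h))"
      using assms by (simp add: perm_def front_Suc)
    then show ?thesis using g h by (intro exI[of _ "Suc g"] exI[of _ "Suc h"]) auto
  next
    case True
    then have y: "y \<in> set (grp g)" using h by simp
    \<comment> \<open>Seam \<open>g\<close> touches only permutations \<open>g\<close> and
      \<open>Suc g\<close>. In a third one, which exists since there are at least two groups, the
      whole group lies in \<open>mid j\<close> and so appears reversed.\<close>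
    obtain j where j: "j \<le> ?n" "j \<noteq> g" "j \<noteq> Suc g"
    proof (cases "g = 0")
      case True
      then show ?thesis using that[of 2] two_groups by auto
    qed (use that[of 0] in auto)
    have "perm (Suc g) = [] @ grp g @ (mid (Suc g) @ rear (Suc g))"
      by (simp add: perm_def front_Suc)
    then have 1: "filter ?P (perm (Suc g)) = filter ?P (grp g)"
      using distinct_perm g(2) y by (rule filter_pair_inner)
    have "set (front j) \<inter> set (grp g) = {}"
    proof (cases j)
      case (Suc l)
      then show ?thesis using grp_disjoint[of l g] j by (simp add: front_Suc)
    qed (simp add: front_0)
    moreover have "set (rear j) \<inter> set (grp g) = {}"
      using grp_disjoint[of j g] set_rear[of j] j by blast
    ultimately have "x \<notin> set (front j)" "y \<notin> set (front j)" "x \<notin> set (rear j)" "y \<notin> set (rear j)"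
      using g(2) y by (simp_all add: disjoint_iff) blast+
    then have "filter ?P (front j) = []" "filter ?P (rear j) = []"
      "filter ?P (mid j) = filter ?P (rev (concat groups))"
      by (auto simp: filter_empty_conv mid_def intro!: filter_cong)
    then have 2: "filter ?P (perm j) = rev (filter ?P (concat groups))"
      by (simp add: perm_def rev_filter)
    have "concat groups = concat (take g groups) @ grp g @ concat (drop (Suc g) groups)"
      using g id_take_nth_drop[of g groups]
      by (metis concat.simps(2) concat_append grp_def)
    then have 3: "filter ?P (concat groups) = filter ?P (grp g)"
      using distinct_groups g(2) y by (rule filter_pair_inner)
    have "filter ?P (perm (Suc g)) \<noteq> filter ?P (perm j)"
      using 1 2 3 pair[of "Suc g"] assms by auto
    then show ?thesis using g j by (intro exI[of _ "Suc g"] exI[of _ j]) auto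
  qed
  then obtain i j where "i < Suc ?n" "j < Suc ?n" "filter ?P (perm i) \<noteq> filter ?P (perm j)"
    using less_Suc_eq_le by metis
  then show ?thesis
    using pair assms disjoint
    by (intro not_alternate_in_blocks[where n = "Suc ?n"
          and f = "\<lambda>i. filter ?P (perm i)" and i = i and j = j] filter_word_letters) auto
qed

section \<open>Alternation between the two sides\<close>

lemma filter_block_pair:
  assumes "a \<in> set (concat groups)" "b \<in> set bs"
  shows "filter (\<lambda>z. z = a \<or> z = b) (block i) =
    filter (\<lambda>z. z = a) (mid i) @ filter (\<lambda>z. z = a) (take (cut i b) (rear i @ grp i)) @
    b # filter (\<lambda>z. z = a) (drop (cut i b) (rear i @ grp i))"
proof -
  have "filter (\<lambda>z. z = a \<or> z = b) (mid i) = filter (\<lambda>z. z = a) (mid i)"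
    using seam_not_bs[OF assms(2)] by (intro filter_cong) auto
  moreover have "a \<notin> set (order i)" using assms disjoint by (auto simp: set_order)
  ultimately show ?thesis
    using seam_not_bs[OF assms(2)] assms(2)
    by (simp add: block_def filter_weave_pair distinct_order set_order)
qed

text \<open>The \<open>takeWhile\<close> in \<open>cut\<close> stops exactly after \<open>p\<close>.
  From the bar, \<open>b\<close> moves left over \<open>rev p\<close> if the head \<open>c\<close>
  is a neighbour, and right over \<open>c # p\<close> otherwise; either way it crosses precisely its
  non-neighbours in the group.\<close>

lemma cut_cases:
  assumes "i < length groups" "b \<in> set bs"
  obtains c p q where "grp i = c # p @ q" "\<forall>a\<in>set p. \<not> adj a b" "\<forall>a\<in>set q. adj a b"
    "take (cut i b) (rear i @ grp i) = (if adj c b then rev q else rear i @ c # p)"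
    "drop (cut i b) (rear i @ grp i) = (if adj c b then rev p @ grp i else q)"
proof -
  have in_groups: "grp i \<in> set groups" using assms by (simp add: grp_def)
  then obtain c t where ct: "grp i = c # t"
    using nonempty_groups by (metis neq_Nil_conv)
  then obtain p q where pq: "t = p @ q" "\<forall>a\<in>set p. \<not> adj a b" "\<forall>a\<in>set q. adj a b"
    using nested[OF in_groups assms(2)] by auto
  have "takeWhile (\<lambda>a. \<not> adj a b) t = p @ takeWhile (\<lambda>a. \<not> adj a b) q"
    using pq by simp
  also have "takeWhile (\<lambda>a. \<not> adj a b) q = []"
    using pq(3) by (cases q) auto
  finally have "cut i b = (if adj c b then length q else length (rear i) + 1 + length p)"
    by (simp add: cut_def ct rear_def pq(1))
  then show ?thesis
    using that[of c p q] ct pq by (simp add: rear_def)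
qed

text \<open>A neighbour is never crossed, so relative to \<open>a\<close> every \<open>b\<close>
  still stands at the bar. Regrouped by permutations, the restriction is a power of
  \<open>[a, b]\<close>.\<close>

lemma alternate_adj:
  assumes a: "a \<in> set (concat groups)" and b: "b \<in> set bs" and "adj a b"
  shows "alternate_in word a b"
proof -
  let ?F = "filter (\<lambda>z. z = a)"
  have "filter (\<lambda>z. z = a \<or> z = b) (block i) = (?F (mid i) @ ?F (rear i) @ [b]) @ ?F (front (Suc i))"
    if "i \<le> length groups" for i
  proof (cases "i = length groups")
    case True
    then show ?thesis
      by (simp add: filter_block_pair[OF a b] grp_last rear_last front_Suc)
  next
    case False
    then have "i < length groups" using that by simp
    then obtain c p q where *: "grp i = c # p @ q" "\<forall>a\<in>set p. \<not> adj a b" "\<forall>a\<in>set q. adj a b"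
      "take (cut i b) (rear i @ grp i) = (if adj c b then rev q else rear i @ c # p)"
      "drop (cut i b) (rear i @ grp i) = (if adj c b then rev p @ grp i else q)"
      using b by (rule cut_cases)
    have p: "a \<notin> set p" using * assms by auto
    have rear: "rear i = rev q @ rev p" by (simp add: rear_def *(1))
    show ?thesis
    proof (cases "adj c b")
      case True
      then show ?thesis
        using p unfolding filter_block_pair[OF a b] *(4,5)
        by (simp add: rear front_Suc filter_eq_none)
    next
      case False
      then have "a \<noteq> c" using assms by auto
      then show ?thesis
        using p False unfolding filter_block_pair[OF a b] *(4,5)
        by (simp add: front_Suc *(1) filter_eq_none)
    qed
  qed
  then have "map (\<lambda>i. filter (\<lambda>z. z = a \<or> z = b) (block i)) [0..<Suc (length groups)]
      = map (\<lambda>i. (?F (mid i) @ ?F (rear i) @ [b]) @ ?F (front (Suc i))) [0..<Suc (length groups)]"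
    by (intro map_cong) auto
  then have "filter (\<lambda>z. z = a \<or> z = b) word
      = concat (map (\<lambda>i. (?F (mid i) @ ?F (rear i) @ [b]) @ ?F (front (Suc i))) [0..<Suc (length groups)])"
    by (simp only: filter_word)
  also have "\<dots> = concat (map (\<lambda>i. ?F (front i) @ ?F (mid i) @ ?F (rear i) @ [b])
      [0..<Suc (length groups)]) @ ?F (front (Suc (length groups)))"
    by (rule concat_shift) (simp add: front_0)
  also have "\<dots> = concat (map (\<lambda>i. ?F (perm i) @ [b]) [0..<Suc (length groups)])"
    by (simp add: perm_def front_Suc grp_last)
  also have "\<dots> = concat (map (\<lambda>i. [a, b]) [0..<Suc (length groups)])"
    using a by (simp add: filter_eq_single distinct_perm set_perm del: set_concat upt_Suc)
  also have "\<dots> = concat (replicate (Suc (length groups)) [a, b])"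
    by (simp add: map_replicate_const del: upt_Suc replicate_Suc)
  finally show ?thesis by (rule alternate_in_blocks)
qed

text \<open>At the seam of the group of \<open>a\<close>, two occurrences of \<open>a\<close> end up
  on the same side of \<open>b\<close>: both after it when \<open>b\<close> moved left, both before
  it when \<open>b\<close> moved right.\<close>

lemma not_alternate_not_adj:
  assumes a: "a \<in> set (concat groups)" and b: "b \<in> set bs" and "\<not> adj a b"
  shows "\<not> alternate_in word a b"
proof -
  let ?F = "filter (\<lambda>z. z = a)"
  obtain i where i: "i < length groups" "a \<in> set (grp i)" using grp_cover a by blast
  obtain c p q where *: "grp i = c # p @ q" "\<forall>a\<in>set p. \<not> adj a b" "\<forall>a\<in>set q. adj a b"
    "take (cut i b) (rear i @ grp i) = (if adj c b then rev q else rear i @ c # p)"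
    "drop (cut i b) (rear i @ grp i) = (if adj c b then rev p @ grp i else q)"
    using i(1) b by (rule cut_cases)
  have grp: "?F (grp i) = [a]" using i distinct_grp by (simp add: filter_eq_single)
  have "\<exists>u v. filter (\<lambda>z. z = a \<or> z = b) (block i) = u @ a # a # v"
  proof (cases "adj c b")
    case True
    then have "a \<in> set (rev p)" using i * assms by auto
    moreover have "distinct (rev p)" using distinct_grp[of i] *(1) by simp
    ultimately have "?F (rev p) = [a]" by (simp add: filter_eq_single del: set_rev distinct_rev)
    then have "filter (\<lambda>z. z = a \<or> z = b) (block i)
        = (?F (mid i) @ ?F (rev q) @ [b]) @ a # a # []"
      using True unfolding filter_block_pair[OF a b] *(4,5) by (simp add: grp)
    then show ?thesis by blast
  next
    case False
    then have "a \<in> set (c # p)" using i * assms by auto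
    moreover have "distinct (c # p)" using distinct_grp[of i] *(1) by simp
    ultimately have cp: "?F (c # p) = [a]" by (intro filter_eq_single)
    \<comment> \<open>Since \<open>a\<close> is not in \<open>front i\<close>, its occurrence in
      permutation \<open>i\<close> falls inside this block, before the bar.\<close>
    have "?F (front i) = []" using front_disjoint[of i] i by (auto simp: filter_empty_conv)
    moreover have "?F (perm i) = [a]"
      using a by (simp add: filter_eq_single distinct_perm set_perm del: set_concat)
    ultimately have mr: "?F (mid i) @ ?F (rear i) = [a]" by (simp add: perm_def)
    have "filter (\<lambda>z. z = a \<or> z = b) (block i)
        = (?F (mid i) @ ?F (rear i)) @ ?F (c # p) @ b # ?F q"
      using False unfolding filter_block_pair[OF a b] *(4,5) by simp
    then have "filter (\<lambda>z. z = a \<or> z = b) (block i) = [] @ a # a # b # ?F q"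
      unfolding mr cp by simp
    then show ?thesis by blast
  qed
  then obtain u v where uv: "filter (\<lambda>z. z = a \<or> z = b) (block i) = u @ a # a # v" by blast
  have "block i \<in> set (map block [0..<Suc (length groups)])" using i by auto
  then obtain us vs where "map block [0..<Suc (length groups)] = us @ block i # vs"
    by (meson split_list)
  then have "word = concat us @ block i @ concat vs" by (simp add: word_def)
  then have "filter (\<lambda>z. z = a \<or> z = b) word = (filter (\<lambda>z. z = a \<or> z = b) (concat us) @ u) @
      a # a # (v @ filter (\<lambda>z. z = a \<or> z = b) (concat vs))"
    using uv by simp
  moreover have "a \<noteq> b" using a b disjoint by auto
  ultimately show ?thesis using not_alternate_in_repeat by metis
qed

end

section \<open>Groups from two chains, and the bound for the graph\<close>

fun pairs :: "'a list \<Rightarrow> 'a list list" where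
  "pairs (x # y # zs) = [x, y] # pairs zs"
| "pairs _ = []"

lemma concat_pairs: "even (length xs) \<Longrightarrow> concat (pairs xs) = xs"
  by (induction xs rule: pairs.induct) auto

lemma length_pairs: "length (pairs xs) = length xs div 2"
  by (induction xs rule: pairs.induct) auto

lemma pairs_form: "p \<in> set (pairs xs) \<Longrightarrow> \<exists>x y. p = [x, y]"
  by (induction xs rule: pairs.induct) auto

lemma two_chain_elements:
  assumes "C \<in> Chains (nbhd_poset G A)" "card C = 2"
  obtains u v where "C = {u, v}" "u \<in> A" "v \<in> A" "u \<noteq> v" "nbhd G u \<subseteq> nbhd G v"
proof -
  obtain x y where xy: "C = {x, y}" "x \<noteq> y" using assms(2) by (auto simp: card_2_iff)
  then have "(x, y) \<in> nbhd_poset G A \<or> (y, x) \<in> nbhd_poset G A"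
    using assms(1) unfolding Chains_def by auto
  then show ?thesis
    using that[of x y] that[of y x] xy unfolding nbhd_poset_def relation_of_def by auto
qed

theorem theorem5:
  fixes G :: "('a, 'b) pre_digraph" and A B :: "'a set" and m k :: nat
  assumes "graph G"
    and "Digraph_Component.connected G"
    and "reduced_graph G"
    and "bipartition G A B"
    and "card A = m"
    and "m \<le> card B"
    and "m = 2 * k"
    and "k \<ge> 3"
    and "poset_height (nbhd_poset G A) = 2"
    and "\<exists>C\<in>Chains (nbhd_poset G A). \<exists>D\<in>Chains (nbhd_poset G A).
           card C = 2 \<and> card D = 2 \<and> C \<inter> D = {}"
  shows "rep_number G \<le> enat k"
proof -
  interpret graph G by fact
  have AB: "A \<union> B = verts G" "A \<inter> B = {}"
    and edge: "\<And>x y. x \<rightarrow>\<^bsub>G\<^esub> y \<Longrightarrow> x \<in> A \<and> y \<in> B \<or> x \<in> B \<and> y \<in> A"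
    using assms(4) unfolding bipartition_def by auto
  have fin: "finite A" "finite B" using AB finite_verts by (metis finite_Un)+
  obtain a1 a2 b1 b2 where chains:
    "a1 \<in> A" "a2 \<in> A" "a1 \<noteq> a2" "nbhd G a1 \<subseteq> nbhd G a2"
    "b1 \<in> A" "b2 \<in> A" "b1 \<noteq> b2" "nbhd G b1 \<subseteq> nbhd G b2" "{a1, a2} \<inter> {b1, b2} = {}"
    using assms(10) two_chain_elements by metis
  define S where "S = A - {a1, a2, b1, b2}"
  have "card {a1, a2, b1, b2} = 4" using chains by auto
  then have cardS: "card S = 2 * k - 4"
    using chains fin assms(5,7) unfolding S_def by (subst card_Diff_subset) auto
  obtain ss where ss: "set ss = S" "distinct ss"
    using finite_distinct_list fin unfolding S_def by blast
  have len: "length ss = 2 * k - 4" using ss cardS distinct_card by metis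
  \<comment> \<open>As \<open>k\<close> is at least 3, at least two letters remain outside the
    chains; they become the heads of the two triples, and an even number is left for the
    pairs.\<close>
  then obtain c d rest where cd: "ss = c # d # rest"
    using assms(8) by (cases ss; cases "tl ss") auto
  obtain bs where bs: "set bs = B" "distinct bs"
    using finite_distinct_list fin by blast
  define gs where "gs = [c, a1, a2] # [d, b1, b2] # pairs rest"
  have len_rest: "length rest = 2 * (k - 3)" using len cd by simp
  then have concat_gs: "concat gs = [c, a1, a2] @ [d, b1, b2] @ rest"
    by (simp add: gs_def concat_pairs)
  have set_gs: "set (concat gs) = A"
    using ss cd chains unfolding concat_gs S_def by auto
  \<comment> \<open>Two triples and \<open>k - 3\<close> pairs make \<open>k - 1\<close> seams,
    hence \<open>k\<close> permutations.\<close>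
  have length_gs: "Suc (length gs) = k"
    using len_rest assms(8) by (simp add: gs_def length_pairs)
  interpret W: seam_word gs bs "\<lambda>a b. a \<rightarrow>\<^bsub>G\<^esub> b"
  proof
    show "2 \<le> length gs" by (simp add: gs_def)
    show "distinct (concat gs)"
      using ss cd chains unfolding concat_gs S_def by auto
    show "[] \<notin> set gs" using pairs_form by (force simp: gs_def)
    show "distinct bs" by fact
    show "set (concat gs) \<inter> set bs = {}" using set_gs bs AB by simp
  next
    fix xs b assume xs: "xs \<in> set gs"
    let ?adj = "\<lambda>a. a \<rightarrow>\<^bsub>G\<^esub> b"
    \<comment> \<open>Inclusion of neighbourhoods excludes the one bad pattern, \<open>u\<close>
      adjacent to \<open>b\<close> and \<open>v\<close> not.\<close>
    have nested: "\<exists>p q. [u, v] = p @ q \<and> (\<forall>a\<in>set p. \<not> ?adj a) \<and> (\<forall>a\<in>set q. ?adj a)"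
      if "nbhd G u \<subseteq> nbhd G v" for u v
    proof -
      consider "?adj u" "?adj v" | "\<not> ?adj u" "?adj v" | "\<not> ?adj u" "\<not> ?adj v"
        using \<open>nbhd G u \<subseteq> nbhd G v\<close> by (auto simp: nbhd_def)
      then show ?thesis
      proof cases
        case 1 then show ?thesis by (intro exI[of _ "[]"] exI[of _ "[u, v]"]) auto
      next
        case 2 then show ?thesis by (intro exI[of _ "[u]"] exI[of _ "[v]"]) auto
      next
        case 3 then show ?thesis by (intro exI[of _ "[u, v]"] exI[of _ "[]"]) auto
      qed
    qed
    \<comment> \<open>The tail of a pair has one letter, so any two letters may be paired.\<close>
    have single: "\<exists>p q. [u] = p @ q \<and> (\<forall>a\<in>set p. \<not> ?adj a) \<and> (\<forall>a\<in>set q. ?adj a)" for u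
    proof (cases "?adj u")
      case True then show ?thesis by (intro exI[of _ "[]"] exI[of _ "[u]"]) auto
    next
      case False then show ?thesis by (intro exI[of _ "[u]"] exI[of _ "[]"]) auto
    qed
    consider "xs = [c, a1, a2]" | "xs = [d, b1, b2]" | x y where "xs = [x, y]"
      using xs pairs_form[of xs rest] by (auto simp: gs_def)
    then show "\<exists>p q. tl xs = p @ q \<and> (\<forall>a\<in>set p. \<not> ?adj a) \<and> (\<forall>a\<in>set q. ?adj a)"
      using nested[OF chains(4)] nested[OF chains(8)] single by cases (simp_all only: list.sel)
  qed
  have "represents W.word G"
    unfolding represents_def
  proof (intro conjI ballI impI)
    show "set W.word = verts G" using W.set_word set_gs bs AB by simp
  next
    fix x y assume xy: "x \<in> verts G" "y \<in> verts G" "x \<noteq> y"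
    have sym: "x \<rightarrow>\<^bsub>G\<^esub> y \<longleftrightarrow> y \<rightarrow>\<^bsub>G\<^esub> x" using arcs_ends_symmetric[OF sym_arcs] by metis
    consider "x \<in> A" "y \<in> A" | "x \<in> A" "y \<in> B" | "x \<in> B" "y \<in> A" | "x \<in> B" "y \<in> B"
      using xy AB by blast
    then show "x \<rightarrow>\<^bsub>G\<^esub> y \<longleftrightarrow> alternate_in W.word x y"
    proof cases
      case 1
      then show ?thesis using W.not_alternate_letters xy edge AB unfolding set_gs by blast
    next
      case 2
      then show ?thesis
        using W.alternate_adj W.not_alternate_not_adj unfolding set_gs bs by blast
    next
      case 3
      then show ?thesis
        using W.alternate_adj W.not_alternate_not_adj sym unfolding set_gs bs
        by (metis alternate_in_commute)
    next
      case 4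
      then show ?thesis using W.not_alternate_bs xy edge AB unfolding bs by blast
    qed
  qed
  moreover have "uniform_word k W.word"
    unfolding uniform_word_def W.set_word
    using W.count_list_letter W.count_list_bs length_gs by blast
  ultimately show ?thesis
    unfolding rep_number_def by (intro INF_lower) blast
qed

end
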